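(* Let $n\geq3$. Among based closed walks $w$ on $Q_n$, $$\min\bigl\{|w|:\ \rho_{T_n}(w)\in\gamma_2(F_{r_n})\setminus\gamma_3(F_{r_n})\bigr\}=14.$$ The walk $W=(000;01012020101202)$, read in the fixed coordinate copy of $Q_3$ in $Q_n$, realizes this minimum.
   Context: $Q_n$ is the $1$-skeleton (graph) of the $n$-dimensional cube: vertex set $\{0,1\}^n$, two vertices adjacent iff they differ in exactly one coordinate. Its cycle rank is $r_n=n2^{n-1}-2^n+1=(n-2)2^{n-1}+1$, and $F_{r_n}$ is the free group of rank $r_n$. For $Q_3$, coordinates are numbered $0,1,2$, a vertex is written $b_2b_1b_0$ ($b_i$ the $i$-th coordinate) and identified with the integer $4b_2+2b_1+b_0$. The notation $(000;a_1\cdots a_m)$ denotes the walk starting at $000$ whose $k$-th step flips coordinate $a_k\in\{0,1,2\}$. The Gray spanning tree of $Q_3$ is the path $000,001,011,010,110,111,101,100$ (i.e. $0,1,3,2,6,7,5,4$); its cotree edges $(0,2),(0,4),(1,5),(3,7),(4,6)$ are oriented from the smaller to the larger integer. Fix a coordinate copy of $Q_3$ in $Q_n$ (three coordinates vary, the others are held constant), with basepoint of $Q_n$ the vertex corresponding to $000$, and a spanning tree $T_n$ of $Q_n$ extending the Gray spanning tree of this copy (for $n=3$, $T_3$ is the Gray tree). The $r_n$ edges of $Q_n$ not in $T_n$ (cotree edges) are each given a fixed orientation, the five cotree edges lying in the copy of $Q_3$, which correspond to $(0,2),(0,4),(1,5),(3,7),(4,6)$, being oriented from the vertex corresponding to the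 smaller integer to the vertex corresponding to the larger integer, and are identified with a free basis of $F_{r_n}$. For a based closed walk $w$ on $Q_n$ (a finite sequence of steps along edges starting and ending at the basepoint, of length $|w|$ the number of steps), reading its steps in order, a forward crossing of a cotree edge contributes the corresponding basis element, a backward crossing its inverse, and a tree edge contributes nothing; $\rho_{T_n}(w)\in F_{r_n}$ is the free reduction of the resulting word. Lower central series: $\gamma_1(F)=F$, $\gamma_{m+1}(F)=[\gamma_m(F),F]$. *)

theory Defs
  imports "HOL-Algebra.Generated_Groups"
begin

text \<open>
  A letter \<open>(x, True)\<close> stands for the generator \<open>x\<close>, and \<open>(x, False)\<close> for its inverse.
\<close>

type_synonym 'g letter = "'g \<times> bool"

definition inv_letter :: "'g letter \<Rightarrow> 'g letter" where
  "inv_letter a = (fst a, \<not> snd a)"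

definition reduced_word :: "'g letter list \<Rightarrow> bool" where
  "reduced_word w \<longleftrightarrow> successively (\<lambda>a b. b \<noteq> inv_letter a) w"

fun cons_reduce :: "'g letter \<Rightarrow> 'g letter list \<Rightarrow> 'g letter list" where
  "cons_reduce a [] = [a]"
| "cons_reduce a (b # w) = (if b = inv_letter a then w else a # b # w)"

definition free_reduction :: "'g letter list \<Rightarrow> 'g letter list" where
  "free_reduction w = foldr cons_reduce w []"

definition free_group :: "'g set \<Rightarrow> 'g letter list monoid" where
  "free_group X =
     \<lparr>carrier = {w. set w \<subseteq> X \<times> UNIV \<and> reduced_word w},
      mult = (\<lambda>u v. free_reduction (u @ v)),
      one = []\<rparr>"

lemma inv_letter_inv_letter [simp]: "inv_letter (inv_letter a) = a"
  by (simp add: inv_letter_def)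

lemma reduced_word_Nil [simp]: "reduced_word []"
  by (simp add: reduced_word_def)

lemma reduced_word_ConsD: "reduced_word (a # w) \<Longrightarrow> reduced_word w"
  by (auto simp: reduced_word_def successively_Cons)

lemma reduced_cons_reduce: "reduced_word w \<Longrightarrow> reduced_word (cons_reduce a w)"
  by (cases w) (auto simp: reduced_word_def successively_Cons)

lemma reduced_foldr: "reduced_word v \<Longrightarrow> reduced_word (foldr cons_reduce w v)"
  by (induction w) (auto intro: reduced_cons_reduce)

lemma reduced_free_reduction: "reduced_word (free_reduction w)"
  by (simp add: free_reduction_def reduced_foldr)

lemma cons_reduce_reduced: "reduced_word (a # w) \<Longrightarrow> cons_reduce a w = a # w"
  by (cases w) (auto simp: reduced_word_def)

lemma free_reduction_reduced: "reduced_word w \<Longrightarrow> free_reduction w = w"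
  unfolding free_reduction_def
proof (induction w)
  case (Cons a w)
  then show ?case using reduced_word_ConsD[of a w] by (simp add: cons_reduce_reduced)
qed simp

lemma cons_reduce_inverse:
  assumes "reduced_word w"
  shows "cons_reduce a (cons_reduce (inv_letter a) w) = w"
proof (cases w)
  case Nil
  then show ?thesis by simp
next
  case (Cons b v)
  show ?thesis
  proof (cases "b = a")
    case True
    then show ?thesis using Cons assms by (simp add: cons_reduce_reduced)
  qed (simp add: Cons)
qed

lemma set_cons_reduce: "set (cons_reduce a w) \<subseteq> insert a (set w)"
  by (cases w) auto

lemma set_free_reduction: "set (free_reduction w) \<subseteq> set w"
  unfolding free_reduction_def
proof (induction w)
  case (Cons a w)
  then show ?case using set_cons_reduce[of a "foldr cons_reduce w []"] by auto
qed simp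

lemma foldr_cons_reduce:
  assumes "reduced_word v" "reduced_word u"
  shows "foldr cons_reduce (cons_reduce a u) v = cons_reduce a (foldr cons_reduce u v)"
proof (cases u)
  case (Cons b w)
  show ?thesis
  proof (cases "b = inv_letter a")
    case True
    have "cons_reduce a (cons_reduce (inv_letter a) (foldr cons_reduce w v)) = foldr cons_reduce w v"
      by (rule cons_reduce_inverse) (simp add: assms(1) reduced_foldr)
    then show ?thesis using Cons True by simp
  qed (simp add: Cons)
qed simp

lemma foldr_free_reduction:
  assumes "reduced_word v"
  shows "foldr cons_reduce (free_reduction u) v = foldr cons_reduce u v"
  unfolding free_reduction_def
proof (induction u)
  case (Cons a u)
  then show ?case
    using foldr_cons_reduce[OF assms reduced_foldr[of "[]" u]] by simp
qed simp

lemma free_reduction_append_left: "free_reduction (free_reduction u @ v) = free_reduction (u @ v)"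
  using foldr_free_reduction[OF reduced_free_reduction[of v], of u]
  by (simp add: free_reduction_def)

lemma free_reduction_append_right: "free_reduction (u @ free_reduction v) = free_reduction (u @ v)"
  using free_reduction_reduced[OF reduced_free_reduction[of v]]
  by (simp add: free_reduction_def)

lemma free_reduction_inverse:
  "free_reduction (map inv_letter (rev w) @ w) = []"
proof (induction w)
  case (Cons a w)
  have "free_reduction (map inv_letter (rev (a # w)) @ a # w)
        = foldr cons_reduce (map inv_letter (rev w))
            (cons_reduce (inv_letter a) (cons_reduce a (free_reduction w)))"
    by (simp add: free_reduction_def)
  also have "\<dots> = free_reduction (map inv_letter (rev w) @ w)"
    using cons_reduce_inverse[OF reduced_free_reduction, of "inv_letter a" w]
    by (simp add: free_reduction_def)
  finally show ?case using Cons.IH by simp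
qed (simp add: free_reduction_def)

lemma group_free_group: "group (free_group X)"
proof (rule groupI)
  fix u assume u: "u \<in> carrier (free_group X)"
  let ?v = "free_reduction (map inv_letter (rev u))"
  have "set ?v \<subseteq> X \<times> UNIV"
    using set_free_reduction[of "map inv_letter (rev u)"] u
    by (fastforce simp: free_group_def inv_letter_def)
  then have "?v \<in> carrier (free_group X)"
    by (simp add: free_group_def reduced_free_reduction)
  moreover have "?v \<otimes>\<^bsub>free_group X\<^esub> u = \<one>\<^bsub>free_group X\<^esub>"
    by (simp add: free_group_def free_reduction_append_left free_reduction_inverse)
  ultimately show "\<exists>v\<in>carrier (free_group X). v \<otimes>\<^bsub>free_group X\<^esub> u = \<one>\<^bsub>free_group X\<^esub>"
    by blast
next
  fix u v assume "u \<in> carrier (free_group X)" "v \<in> carrier (free_group X)"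
  then show "u \<otimes>\<^bsub>free_group X\<^esub> v \<in> carrier (free_group X)"
    using set_free_reduction[of "u @ v"] by (auto simp: free_group_def reduced_free_reduction)
qed (simp_all add: free_group_def free_reduction_append_left free_reduction_append_right
      free_reduction_reduced)

definition commutator_subgroup ::
    "('a, 'b) monoid_scheme \<Rightarrow> 'a set \<Rightarrow> 'a set \<Rightarrow> 'a set" where
  "commutator_subgroup G H K =
     generate G (\<Union>h\<in>H. \<Union>k\<in>K. {h \<otimes>\<^bsub>G\<^esub> k \<otimes>\<^bsub>G\<^esub> inv\<^bsub>G\<^esub> h \<otimes>\<^bsub>G\<^esub> inv\<^bsub>G\<^esub> k})"

text \<open>The series is indexed from \<open>1\<close>; the value at \<open>0\<close> is a dummy.\<close>

fun lower_central :: "('a, 'b) monoid_scheme \<Rightarrow> nat \<Rightarrow> 'a set" where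
  "lower_central G 0 = carrier G"
| "lower_central G (Suc 0) = carrier G"
| "lower_central G (Suc (Suc m)) =
     commutator_subgroup G (lower_central G (Suc m)) (carrier G)"

text \<open>
  A vertex of the \<open>n\<close>-cube is a list of \<open>n\<close> bits whose entry at position \<open>i\<close> is the \<open>i\<close>-th
  coordinate. An undirected edge is the two-element set of its ends.
\<close>

type_synonym vertex = "bool list"

definition cube_verts :: "nat \<Rightarrow> vertex set" where
  "cube_verts n = {v. length v = n}"

definition cube_adj :: "nat \<Rightarrow> vertex \<Rightarrow> vertex \<Rightarrow> bool" where
  "cube_adj n u v \<longleftrightarrow>
     u \<in> cube_verts n \<and> v \<in> cube_verts n \<and> (\<exists>!i. i < n \<and> u ! i \<noteq> v ! i)"

definition cube_edges :: "nat \<Rightarrow> vertex set set" where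
  "cube_edges n = {{u, v} | u v. cube_adj n u v}"

text \<open>The natural-number subtraction does not truncate when \<open>n \<ge> 1\<close>.\<close>

definition cycle_rank :: "nat \<Rightarrow> nat" where
  "cycle_rank n = n * 2 ^ (n - 1) + 1 - 2 ^ n"

definition path_edges :: "'v list \<Rightarrow> 'v set set" where
  "path_edges p = {{u, v} | u v. (u, v) \<in> set (zip p (tl p))}"

definition graph_cycle :: "'v set set \<Rightarrow> 'v list \<Rightarrow> bool" where
  "graph_cycle E p \<longleftrightarrow>
     3 \<le> length p \<and> distinct p \<and> path_edges p \<subseteq> E \<and> {last p, hd p} \<in> E"

definition spanning_tree :: "'v set \<Rightarrow> 'v set set \<Rightarrow> 'v set set \<Rightarrow> bool" where
  "spanning_tree V E T \<longleftrightarrow>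
     T \<subseteq> E \<and>
     (\<forall>u\<in>V. \<forall>v\<in>V. (u, v) \<in> {(x, y). {x, y} \<in> T}\<^sup>*) \<and>
     (\<nexists>p. graph_cycle T p)"

text \<open>
  A walk is the nonempty list of the vertices it visits, so a walk with \<open>m\<close> steps is a list of
  length \<open>m + 1\<close>.
\<close>

definition closed_walk :: "nat \<Rightarrow> vertex \<Rightarrow> vertex list \<Rightarrow> bool" where
  "closed_walk n v w \<longleftrightarrow>
     w \<noteq> [] \<and> set w \<subseteq> cube_verts n \<and> successively (cube_adj n) w \<and> hd w = v \<and> last w = v"

definition walk_length :: "vertex list \<Rightarrow> nat" where
  "walk_length w = length w - 1"

definition flip :: "nat \<Rightarrow> vertex \<Rightarrow> vertex" where
  "flip i v = v[i := \<not> v ! i]"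

fun flip_walk :: "vertex \<Rightarrow> nat list \<Rightarrow> vertex list" where
  "flip_walk v [] = [v]"
| "flip_walk v (i # is) = v # flip_walk (flip i v) is"

text \<open>
  An orientation of a set of edges chooses for each edge exactly one of its two ordered pairs of
  ends.
\<close>

definition orientation :: "'v set set \<Rightarrow> ('v \<times> 'v) set \<Rightarrow> bool" where
  "orientation C D \<longleftrightarrow> bij_betw (\<lambda>(u, v). {u, v}) D C"

text \<open>
  The word read by a walk, given the set \<open>D\<close> of oriented cotree edges and the labelling \<open>\<beta>\<close> of
  these by generators.
\<close>

definition step_word ::
    "('v \<times> 'v) set \<Rightarrow> ('v \<times> 'v \<Rightarrow> 'g) \<Rightarrow> 'v \<times> 'v \<Rightarrow> 'g letter list" where
  "step_word D \<beta> = (\<lambda>(u, v).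
     if (u, v) \<in> D then [(\<beta> (u, v), True)]
     else if (v, u) \<in> D then [(\<beta> (v, u), False)]
     else [])"

definition walk_word ::
    "('v \<times> 'v) set \<Rightarrow> ('v \<times> 'v \<Rightarrow> 'g) \<Rightarrow> 'v list \<Rightarrow> 'g letter list" where
  "walk_word D \<beta> w = free_reduction (concat (map (step_word D \<beta>) (zip w (tl w))))"

text \<open>
  The copy in which coordinates \<open>c 0\<close>, \<open>c 1\<close>, \<open>c 2\<close> vary and all others keep their values in \<open>h\<close>
  (whose own entries at \<open>c 0\<close>, \<open>c 1\<close>, \<open>c 2\<close> are overwritten, hence irrelevant). The vertex with
  bits \<open>b\<^sub>2 b\<^sub>1 b\<^sub>0\<close> is addressed by \<open>k = 4 b\<^sub>2 + 2 b\<^sub>1 + b\<^sub>0\<close>.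
\<close>

definition copy_vertex :: "vertex \<Rightarrow> (nat \<Rightarrow> nat) \<Rightarrow> nat \<Rightarrow> vertex" where
  "copy_vertex h c k = h[c 0 := bit k 0, c 1 := bit k 1, c 2 := bit k 2]"

definition gray_path :: "nat list" where
  "gray_path = [0, 1, 3, 2, 6, 7, 5, 4]"

definition gray_cotree :: "(nat \<times> nat) set" where
  "gray_cotree = {(0, 2), (0, 4), (1, 5), (3, 7), (4, 6)}"

definition W_steps :: "nat list" where
  "W_steps = [0, 1, 0, 1, 2, 0, 2, 0, 1, 0, 1, 2, 0, 2]"

end

theory Submission
  imports Defs
begin

text \<open>
  Why the minimum is \<open>14\<close>. Suppose \<open>\<rho>(w)\<close> lies in \<open>\<gamma>\<^sub>2\<close>. Then every generator has exponent sum
  \<open>0\<close> (\<open>exponent_sum_lower_central_2\<close>), so \<open>w\<close> crosses every cotree edge equally often in both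
  directions. The same holds for a tree edge \<open>e\<close>: removing \<open>e\<close> splits the tree into two parts, the
  closed walk has net flow \<open>0\<close> across this cut, and the cotree edges of the cut contribute nothing
  (\<open>balanced_if_cotree_balanced\<close>). So \<open>w\<close> is balanced on every edge.

  A nonempty balanced closed walk with fewer than \<open>14\<close> steps has a spur, that is, two cyclically
  consecutive steps that are reverse to each other (\<open>closed_balanced_darts_have_spur\<close>). Otherwise
  the edges it uses form a graph of minimum degree at least \<open>2\<close>, each edge being used at least
  twice. If this graph has a vertex of degree at least \<open>3\<close> then it has at least \<open>7\<close> edges, because
  the cube is bipartite and contains no \<open>K\<^sub>2\<^sub>,\<^sub>3\<close> (\<open>card_darts_ge_14\<close>). If all degrees are \<open>2\<close>, the walk
  can never turn around, so it cannot be balanced. Removing a spur changes neither balance nor, up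
  to conjugation, the element read. Hence a walk with \<open>\<rho>(w) \<in> \<gamma>\<^sub>2\<close> and fewer than \<open>14\<close> steps reads the
  trivial element, which lies in \<open>\<gamma>\<^sub>3\<close> (\<open>short_walk_word_trivial\<close>).

  The walk \<open>W\<close> reads the commutator of \<open>a\<^sup>-\<^sup>1\<close> and \<open>b c\<^sup>-\<^sup>1\<close>, where \<open>a\<close>, \<open>b\<close>, \<open>c\<close> are the generators of
  the cotree edges \<open>(0, 2)\<close>, \<open>(0, 4)\<close>, \<open>(1, 5)\<close>. It lies in \<open>\<gamma>\<^sub>2\<close>. It does not lie in \<open>\<gamma>\<^sub>3\<close>, because the
  homomorphism to the integral Heisenberg group that sends \<open>a\<close> and \<open>b\<close> to the two standard
  generators and all other generators to \<open>1\<close> kills \<open>\<gamma>\<^sub>3\<close> but not this commutator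
  (\<open>commutator_word_in_lower_central_2\<close>).
\<close>

section \<open>Evaluating words in a group\<close>

text \<open>
  The value in the group \<open>H\<close> of a word whose generator \<open>x\<close> is interpreted as \<open>f x\<close>. On reduced words
  this is the homomorphism given by the universal property of the free group.
\<close>

definition word_value :: "('a, 'b) monoid_scheme \<Rightarrow> ('g \<Rightarrow> 'a) \<Rightarrow> 'g letter list \<Rightarrow> 'a" where
  "word_value H f w =
     foldr (\<lambda>a g. (if snd a then f (fst a) else inv\<^bsub>H\<^esub> f (fst a)) \<otimes>\<^bsub>H\<^esub> g) w \<one>\<^bsub>H\<^esub>"

context
  fixes H :: "('a, 'b) monoid_scheme" (structure) and f :: "'g \<Rightarrow> 'a"
  assumes H: "group H" and f: "\<And>x. f x \<in> carrier H"
begin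

interpretation group H by (rule H)

lemma word_value_Nil: "word_value H f [] = \<one>"
  by (simp add: word_value_def)

lemma word_value_Cons:
  "word_value H f (a # w) = (if snd a then f (fst a) else inv f (fst a)) \<otimes> word_value H f w"
  by (simp add: word_value_def)

lemma word_value_closed: "word_value H f w \<in> carrier H"
  by (induction w) (auto simp: word_value_Nil word_value_Cons f)

lemma word_value_append: "word_value H f (u @ v) = word_value H f u \<otimes> word_value H f v"
  by (induction u) (auto simp: word_value_Nil word_value_Cons f word_value_closed m_assoc)

lemma word_value_cons_reduce: "word_value H f (cons_reduce a w) = word_value H f (a # w)"
proof (cases w)
  case (Cons b v)
  show ?thesis
    by (auto simp: Cons word_value_Cons inv_letter_def f word_value_closed m_assoc[symmetric])
qed simp

lemma word_value_free_reduction: "word_value H f (free_reduction w) = word_value H f w"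
  unfolding free_reduction_def
  by (induction w) (simp_all add: word_value_cons_reduce word_value_Cons)

lemma word_value_hom: "word_value H f \<in> hom (free_group X) H"
  by (rule homI)
    (simp_all add: free_group_def word_value_free_reduction word_value_append word_value_closed)

end

section \<open>The lower central series under homomorphisms\<close>

lemma lower_central_in_carrier:
  assumes "group G" shows "lower_central G m \<subseteq> carrier G"
proof -
  interpret group G by (rule assms)
  show ?thesis
  proof (induction m rule: nat_induct)
    case (Suc m)
    show ?case
    proof (cases m)
      case m: (Suc k)
      have "generate G (\<Union>h\<in>lower_central G m. \<Union>k\<in>carrier G. {h \<otimes>\<^bsub>G\<^esub> k \<otimes>\<^bsub>G\<^esub> inv\<^bsub>G\<^esub> h \<otimes>\<^bsub>G\<^esub> inv\<^bsub>G\<^esub> k})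
          \<subseteq> carrier G"
        by (rule generate_incl) (use Suc in auto)
      then show ?thesis by (simp add: m commutator_subgroup_def)
    qed auto
  qed auto
qed

lemma hom_lower_central:
  assumes G: "group G" and H: "group H" and \<phi>: "\<phi> \<in> hom G H"
  shows "\<phi> ` lower_central G m \<subseteq> lower_central H m"
proof -
  interpret group_hom G H \<phi>
    using G H \<phi> by (simp add: group_hom_def group_hom_axioms_def)
  show ?thesis
  proof (induction m rule: nat_induct)
    case (Suc m)
    show ?case
    proof (cases m)
      case m: (Suc k)
      let ?K = "\<lambda>G L. \<Union>h\<in>L. \<Union>k\<in>carrier G. {h \<otimes>\<^bsub>G\<^esub> k \<otimes>\<^bsub>G\<^esub> inv\<^bsub>G\<^esub> h \<otimes>\<^bsub>G\<^esub> inv\<^bsub>G\<^esub> k}"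
      have sub: "lower_central G m \<subseteq> carrier G" by (rule lower_central_in_carrier[OF G])
      have "\<phi> ` generate G (?K G (lower_central G m)) = generate H (\<phi> ` ?K G (lower_central G m))"
        by (rule generate_img[symmetric]) (use sub in auto)
      also have "\<dots> \<subseteq> generate H (?K H (lower_central H m))"
      proof (rule H.mono_generate, clarsimp)
        fix h k assume "h \<in> lower_central G m" "k \<in> carrier G"
        then show "\<exists>h'\<in>lower_central H m. \<exists>k'\<in>carrier H.
            \<phi> (h \<otimes>\<^bsub>G\<^esub> k \<otimes>\<^bsub>G\<^esub> inv\<^bsub>G\<^esub> h \<otimes>\<^bsub>G\<^esub> inv\<^bsub>G\<^esub> k)
              = h' \<otimes>\<^bsub>H\<^esub> k' \<otimes>\<^bsub>H\<^esub> inv\<^bsub>H\<^esub> h' \<otimes>\<^bsub>H\<^esub> inv\<^bsub>H\<^esub> k'"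
          using Suc sub by (intro bexI[of _ "\<phi> h"] bexI[of _ "\<phi> k"]) auto
      qed
      finally show ?thesis by (simp add: m commutator_subgroup_def)
    qed auto
  qed auto
qed

section \<open>The Heisenberg group\<close>

text \<open>
  The integral Heisenberg group: \<open>(p, q, r)\<close> stands for the upper unitriangular matrix with \<open>p\<close>, \<open>q\<close>
  next to the diagonal and \<open>r\<close> in the corner. It is nilpotent of class \<open>2\<close>.
\<close>

definition heisenberg :: "(int \<times> int \<times> int) monoid" where
  "heisenberg =
     \<lparr>carrier = UNIV,
      mult = (\<lambda>(p, q, r) (p', q', r'). (p + p', q + q', r + r' + p * q')),
      one = (0, 0, 0)\<rparr>"

lemma heisenberg_simps [simp]:
  "carrier heisenberg = UNIV"
  "(p, q, r) \<otimes>\<^bsub>heisenberg\<^esub> (p', q', r') = (p + p', q + q', r + r' + p * q')"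
  "\<one>\<^bsub>heisenberg\<^esub> = (0, 0, 0)"
  by (simp_all add: heisenberg_def)

lemma group_heisenberg: "group heisenberg"
proof (rule groupI)
  fix x :: "int \<times> int \<times> int"
  obtain p q r where x: "x = (p, q, r)" by (cases x)
  have "(- p, - q, p * q - r) \<otimes>\<^bsub>heisenberg\<^esub> x = \<one>\<^bsub>heisenberg\<^esub>" by (simp add: x)
  then show "\<exists>y\<in>carrier heisenberg. y \<otimes>\<^bsub>heisenberg\<^esub> x = \<one>\<^bsub>heisenberg\<^esub>"
    by (metis UNIV_I heisenberg_simps(1))
qed (auto simp: algebra_simps)

lemma inv_heisenberg [simp]: "inv\<^bsub>heisenberg\<^esub> (p, q, r) = (- p, - q, p * q - r)"
  by (rule group.inv_equality[OF group_heisenberg]) simp_all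

lemma lower_central_heisenberg_2: "lower_central heisenberg 2 \<subseteq> {(0, 0, r) | r. True}"
proof
  fix x assume "x \<in> lower_central heisenberg 2"
  then have "x \<in> generate heisenberg (\<Union>h. \<Union>k. {h \<otimes>\<^bsub>heisenberg\<^esub> k \<otimes>\<^bsub>heisenberg\<^esub>
      inv\<^bsub>heisenberg\<^esub> h \<otimes>\<^bsub>heisenberg\<^esub> inv\<^bsub>heisenberg\<^esub> k})"
    by (simp add: numeral_2_eq_2 commutator_subgroup_def)
  then show "x \<in> {(0, 0, r) | r. True}"
    by (induction rule: generate.induct) auto
qed

lemma lower_central_heisenberg_3: "lower_central heisenberg 3 \<subseteq> {(0, 0, 0)}"
proof
  fix x assume "x \<in> lower_central heisenberg 3"
  then have "x \<in> generate heisenberg (\<Union>h\<in>lower_central heisenberg 2. \<Union>k. {h \<otimes>\<^bsub>heisenberg\<^esub> k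
      \<otimes>\<^bsub>heisenberg\<^esub> inv\<^bsub>heisenberg\<^esub> h \<otimes>\<^bsub>heisenberg\<^esub> inv\<^bsub>heisenberg\<^esub> k})"
    by (simp add: numeral_3_eq_3 numeral_2_eq_2 commutator_subgroup_def)
  then show "x \<in> {(0, 0, 0)}"
    by (induction rule: generate.induct) (use lower_central_heisenberg_2 in \<open>fastforce+\<close>)
qed

text \<open>
  The homomorphism that sends \<open>x\<close> and \<open>y\<close> to the standard generators and all other
  generators to the identity. If \<open>x = y\<close>, this generator goes to \<open>(1, 1, 0)\<close>.
\<close>

definition heisenberg_value :: "'g \<Rightarrow> 'g \<Rightarrow> 'g letter list \<Rightarrow> int \<times> int \<times> int" where
  "heisenberg_value x y =
     word_value heisenberg (\<lambda>z. (of_bool (z = x), of_bool (z = y), 0))"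

lemma heisenberg_value_lower_central:
  "w \<in> lower_central (free_group X) m \<Longrightarrow> heisenberg_value x y w \<in> lower_central heisenberg m"
  using hom_lower_central[OF group_free_group group_heisenberg word_value_hom[OF group_heisenberg]]
  unfolding heisenberg_value_def by fastforce

lemmas heisenberg_value_free_reduction =
  word_value_free_reduction[OF group_heisenberg, where f = "\<lambda>z. (of_bool (z = x), of_bool (z = y), 0)"
    for x y, simplified, folded heisenberg_value_def]

text \<open>The number of occurrences of \<open>x\<close> minus the number of occurrences of its inverse.\<close>

definition exponent_sum :: "'g \<Rightarrow> 'g letter list \<Rightarrow> int" where
  "exponent_sum x w = (\<Sum>a\<leftarrow>w. if fst a = x then (if snd a then 1 else - 1) else 0)"

lemma fst_heisenberg_value: "fst (heisenberg_value x y w) = exponent_sum x w"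
proof (induction w)
  case (Cons a w)
  then show ?case
    by (cases "heisenberg_value x y w")
      (auto simp: heisenberg_value_def word_value_def exponent_sum_def)
qed (simp add: heisenberg_value_def word_value_def exponent_sum_def)

lemma exponent_sum_lower_central_2:
  assumes "free_reduction w \<in> lower_central (free_group X) 2"
  shows "exponent_sum x w = 0"
proof -
  have "heisenberg_value x x w \<in> {(0, 0, r) | r. True}"
    using heisenberg_value_lower_central[OF assms, of x x] lower_central_heisenberg_2
    by (auto simp: heisenberg_value_free_reduction)
  then show ?thesis using fst_heisenberg_value[of x x w] by auto
qed

section \<open>Cancellation in free reduction\<close>

lemma free_reduction_cancel:
  "free_reduction (a # inv_letter a # w) = free_reduction w"
  using cons_reduce_inverse[OF reduced_free_reduction, of a w] by (simp add: free_reduction_def)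

text \<open>Triviality of the element read is invariant under cyclic rotation of the word.\<close>

lemma free_reduction_append_commute_Nil:
  assumes "free_reduction (u @ v) = []"
  shows "free_reduction (v @ u) = []"
proof -
  let ?F = "free_group UNIV :: 'a letter list monoid"
  interpret group ?F by (rule group_free_group)
  have "free_reduction u \<in> carrier ?F" "free_reduction v \<in> carrier ?F"
    by (simp_all add: free_group_def reduced_free_reduction)
  moreover have "free_reduction u \<otimes>\<^bsub>?F\<^esub> free_reduction v = \<one>\<^bsub>?F\<^esub>"
    using assms by (simp add: free_group_def free_reduction_append_left free_reduction_append_right)
  ultimately have "free_reduction v \<otimes>\<^bsub>?F\<^esub> free_reduction u = \<one>\<^bsub>?F\<^esub>"
    using inv_comm by blast
  then show ?thesis
    by (simp add: free_group_def free_reduction_append_left free_reduction_append_right)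
qed


section \<open>Short closed walks in bipartite graphs without K(2,3)\<close>

text \<open>
  A graph is given by its set of darts (ordered pairs of adjacent vertices), and \<open>p\<close> is its
  two-colouring. The second condition says that distinct vertices do not have three common neighbours.
\<close>

definition bipartite_K23_free :: "('v \<Rightarrow> bool) \<Rightarrow> ('v \<times> 'v) set \<Rightarrow> bool" where
  "bipartite_K23_free p E \<longleftrightarrow>
     (\<forall>(u, v) \<in> E. p u \<noteq> p v) \<and>
     (\<forall>u v x y z. distinct [x, y, z] \<longrightarrow>
        {(u, x), (u, y), (u, z), (v, x), (v, y), (v, z)} \<subseteq> E \<longrightarrow> u = v)"

lemma bipartite_K23_free_mono:
  "bipartite_K23_free p E \<Longrightarrow> A \<subseteq> E \<Longrightarrow> bipartite_K23_free p A"
  unfolding bipartite_K23_free_def by (intro conjI; blast)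

text \<open>
  The seven edges that arise at a vertex \<open>v\<close> with neighbours \<open>x\<close>, \<open>y\<close>, \<open>z\<close>: the edges from these to
  \<open>v\<close>, one further edge at each of them, and one further edge at \<open>x'\<close>. With their reversals they are
  \<open>14\<close> darts.
\<close>

lemma card_ge_14_if_seven_darts:
  fixes p :: "'v \<Rightarrow> bool"
  assumes "finite A" "sym A" and bip: "\<And>u v. (u, v) \<in> A \<Longrightarrow> p u \<noteq> p v"
    and mem: "(x, v) \<in> A" "(y, v) \<in> A" "(z, v) \<in> A" "(x, x') \<in> A" "(y, y') \<in> A" "(z, z') \<in> A"
      "(x', t) \<in> A"
    and neq: "distinct [x, y, z]" "x' \<notin> {v, y', z'}" "y' \<noteq> v" "z' \<noteq> v" "t \<noteq> x"
  shows "14 \<le> card A"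
proof -
  let ?L = "[(x, v), (y, v), (z, v), (x, x'), (y, y'), (z, z'), (t, x')]"
  have L: "set ?L \<subseteq> A" using mem symD[OF \<open>sym A\<close>] by auto
  \<comment> \<open>All seven darts start in the colour class of \<open>x\<close>, so none is the reversal of another.\<close>
  have parity: "p a \<longleftrightarrow> p x" "p b \<longleftrightarrow> \<not> p x" if "(a, b) \<in> set ?L" for a b
    using that bip[OF mem(1)] bip[OF mem(2)] bip[OF mem(3)] bip[OF mem(4)] bip[OF mem(5)]
      bip[OF mem(6)] bip[OF mem(7)] by auto
  have "set ?L \<inter> set (map prod.swap ?L) = {}"
  proof (rule equals0I)
    fix d assume "d \<in> set ?L \<inter> set (map prod.swap ?L)"
    then obtain a b where ab: "(a, b) \<in> set ?L" "(a, b) \<in> set (map prod.swap ?L)"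
      by (cases d) blast
    then have "(b, a) \<in> set ?L" unfolding set_map pair_in_swap_image by blast
    with ab(1) show False using parity by blast
  qed
  moreover have "distinct ?L" using neq by auto
  ultimately have "distinct (?L @ map prod.swap ?L)"
    by (simp only: distinct_append distinct_map) (meson inj_swap inj_on_subset subset_UNIV)
  then have "card (set (?L @ map prod.swap ?L)) = 14" by (subst distinct_card) simp_all
  moreover have "set (?L @ map prod.swap ?L) \<subseteq> A" using L symD[OF \<open>sym A\<close>]
    by (simp only: set_append set_map) auto
  ultimately show ?thesis using card_mono[OF \<open>finite A\<close>] by metis
qed

text \<open>A graph of minimum degree at least \<open>2\<close> with a vertex of degree at least \<open>3\<close> has seven edges.\<close>

lemma card_darts_ge_14:
  assumes fin: "finite A" and sym: "sym A" and A: "bipartite_K23_free p A"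
    and ext: "\<And>u v. (u, v) \<in> A \<Longrightarrow> \<exists>t. (v, t) \<in> A \<and> t \<noteq> u"
    and branch: "(v, x) \<in> A" "(v, y) \<in> A" "(v, z) \<in> A" "distinct [x, y, z]"
  shows "14 \<le> card A"
proof -
  have bip: "p a \<noteq> p b" if "(a, b) \<in> A" for a b
    using A that by (auto simp: bipartite_K23_free_def)
  obtain x' y' z' where x': "(x, x') \<in> A" "x' \<noteq> v" and y': "(y, y') \<in> A" "y' \<noteq> v"
    and z': "(z, z') \<in> A" "z' \<noteq> v"
    using ext branch by meson
  obtain tx ty tz where tx: "(x', tx) \<in> A" "tx \<noteq> x" and ty: "(y', ty) \<in> A" "ty \<noteq> y"
    and tz: "(z', tz) \<in> A" "tz \<noteq> z"
    using ext x' y' z' by meson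
  have rev: "(x, v) \<in> A" "(y, v) \<in> A" "(z, v) \<in> A" using branch symD[OF sym] by auto
  have "\<not> (x' = y' \<and> x' = z')"
  proof
    assume eq: "x' = y' \<and> x' = z'"
    then have "{(v, x), (v, y), (v, z), (x', x), (x', y), (x', z)} \<subseteq> A"
      using branch x' y' z' symD[OF sym] by auto
    then have "v = x'" using A branch(4) unfolding bipartite_K23_free_def by blast
    then show False using x' by simp
  qed
  \<comment> \<open>Three vertices that are not all equal include one that differs from both others.\<close>
  then consider "x' \<notin> {y', z'}" | "y' \<notin> {x', z'}" | "z' \<notin> {x', y'}" by auto
  then show ?thesis
  proof cases
    case 1
    show ?thesis
      by (rule card_ge_14_if_seven_darts[OF fin sym bip rev(1,2,3) x'(1) y'(1) z'(1) tx(1)])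
        (use 1 branch(4) x' y' z' tx in auto)
  next
    case 2
    show ?thesis
      by (rule card_ge_14_if_seven_darts[OF fin sym bip rev(2,1,3) y'(1) x'(1) z'(1) ty(1)])
        (use 2 branch(4) x' y' z' ty in auto)
  next
    case 3
    show ?thesis
      by (rule card_ge_14_if_seven_darts[OF fin sym bip rev(3,1,2) z'(1) x'(1) y'(1) tz(1)])
        (use 3 branch(4) x' y' z' tz in auto)
  qed
qed

text \<open>
  A closed walk as the cyclic list of its darts. The empty list counts as closed.
\<close>

definition closed_darts :: "('v \<times> 'v) list \<Rightarrow> bool" where
  "closed_darts ds \<longleftrightarrow> (\<forall>i<length ds. fst (ds ! (Suc i mod length ds)) = snd (ds ! i))"

text \<open>Every edge is traversed equally often in both directions.\<close>

definition balanced :: "('v \<times> 'v) list \<Rightarrow> bool" where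
  "balanced ds \<longleftrightarrow> (\<forall>d. count_list ds (prod.swap d) = count_list ds d)"

lemma balanced_sym: "balanced ds \<Longrightarrow> sym (set ds)"
proof (rule symI)
  fix u v assume "balanced ds" "(u, v) \<in> set ds"
  then show "(v, u) \<in> set ds"
    unfolding balanced_def by (metis count_list_0_iff swap_simp)
qed

text \<open>
  Without a spur and without a branch vertex each dart \<open>e i\<close> determines both \<open>e (i + 1)\<close> and
  \<open>e (i - 1)\<close>. As the reversal of \<open>e 0\<close> is some \<open>e k\<close>, the stretch from \<open>e 0\<close> to \<open>e k\<close> is its own
  reversal, which is impossible in its middle.
\<close>

lemma closed_balanced_darts_have_spur:
  assumes closed: "closed_darts ds" and bal: "balanced ds"
    and graph: "bipartite_K23_free p (set ds)"
    and ds: "ds \<noteq> []" "length ds < 14"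
  shows "\<exists>i<length ds. ds ! (Suc i mod length ds) = prod.swap (ds ! i)"
proof (rule ccontr)
  let ?m = "length ds"
  assume no_spur: "\<not> ?thesis"
  define e where "e i = ds ! (i mod ?m)" for i
  have m: "0 < ?m" using ds by simp
  have e_mem: "e i \<in> set ds" for i using m by (simp add: e_def)
  have e_Suc: "fst (e (Suc i)) = snd (e i)" for i
    using closed m mod_less_divisor[OF m, of i]
    unfolding closed_darts_def e_def by (metis mod_Suc_eq)
  have e_turn: "snd (e (Suc i)) \<noteq> fst (e i)" for i
  proof
    assume "snd (e (Suc i)) = fst (e i)"
    then have "e (Suc i) = prod.swap (e i)" using e_Suc[of i] by (simp add: prod_eq_iff)
    then have "ds ! (Suc (i mod ?m) mod ?m) = prod.swap (ds ! (i mod ?m))"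
      by (simp add: e_def mod_Suc_eq)
    then show False using no_spur m by auto
  qed
  have e_ex: "\<exists>i<?m. d = e i" if "d \<in> set ds" for d
    using that unfolding in_set_conv_nth e_def by (metis mod_less)
  note sym = balanced_sym[OF bal]
  have swap_mem: "prod.swap d \<in> set ds" if "d \<in> set ds" for d
    using that by (metis symD[OF sym] surj_pair swap_simp)
  have bip: "p u \<noteq> p v" if "(u, v) \<in> set ds" for u v
    using graph that by (auto simp: bipartite_K23_free_def)
  have ext: "\<exists>t. (v, t) \<in> set ds \<and> t \<noteq> u" if uv: "(u, v) \<in> set ds" for u v
  proof -
    obtain i where "(u, v) = e i" using e_ex[OF uv] by auto
    then have "(v, snd (e (Suc i))) = e (Suc i)" "snd (e (Suc i)) \<noteq> u"
      using e_Suc[of i] e_turn[of i] by (auto simp: prod_eq_iff)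
    then show ?thesis using e_mem[of "Suc i"] by metis
  qed
  have two: "x = y \<or> x = z \<or> y = z"
    if "(v, x) \<in> set ds" "(v, y) \<in> set ds" "(v, z) \<in> set ds" for v x y z
  proof (rule ccontr)
    assume "\<not> ?thesis"
    then have "14 \<le> card (set ds)"
      by (intro card_darts_ge_14[OF _ sym graph ext that]) auto
    then show False using card_length[of ds] ds by linarith
  qed
  obtain k where k: "prod.swap (e 0) = e k" using e_ex[OF swap_mem[OF e_mem]] by auto
  \<comment> \<open>Moving forward from \<open>e j\<close> and backward from its reversal, the next dart is forced on both sides.\<close>
  have palindrome: "e (k - j) = prod.swap (e j)" if "j \<le> k" for j
    using that
  proof (induction j)
    case (Suc j)
    define i where "i = k - Suc j"
    have i: "Suc i = k - j" using Suc.prems by (simp add: i_def)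
    have IH: "e (Suc i) = prod.swap (e j)" using Suc i by simp
    obtain u v where uv: "e j = (u, v)" by fastforce
    obtain t where t: "e (Suc j) = (v, t)" "t \<noteq> u"
      using e_Suc[of j] e_turn[of j] uv by (cases "e (Suc j)") auto
    obtain s where s: "e i = (s, v)" "s \<noteq> u"
      using e_Suc[of i] e_turn[of i] uv IH by (cases "e i") auto
    have "(v, u) \<in> set ds" "(v, t) \<in> set ds" "(v, s) \<in> set ds"
      using swap_mem[OF e_mem[of j]] e_mem[of "Suc j"] swap_mem[OF e_mem[of i]] uv t s by auto
    then have "s = t" using two t s by metis
    then show ?case using t s by (simp add: i_def)
  qed (simp add: k)
  show False
  proof (cases "even k")
    case True
    then obtain j where j: "k = 2 * j" by blast
    then have "e j = prod.swap (e j)" using palindrome[of j] by simp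
    then have "fst (e j) = snd (e j)" by (metis fst_swap)
    then show False using bip e_mem[of j] by (metis prod.collapse)
  next
    case False
    then obtain j where j: "k = Suc (2 * j)" using oddE by fastforce
    then have "e (Suc j) = prod.swap (e j)" using palindrome[of j] by simp
    then show False using e_turn[of j] by simp
  qed
qed

lemma closed_darts_rotate1:
  assumes "closed_darts ds" shows "closed_darts (rotate1 ds)"
  unfolding closed_darts_def
proof (intro allI impI)
  fix i assume "i < length (rotate1 ds)"
  then have "0 < length ds" by (cases ds) simp_all
  then have "Suc j mod length ds < length ds" for j by simp
  then show "fst (rotate1 ds ! (Suc i mod length (rotate1 ds))) = snd (rotate1 ds ! i)"
    using assms \<open>i < length (rotate1 ds)\<close> unfolding closed_darts_def by (simp add: nth_rotate1)
qed

lemma closed_darts_rotate: "closed_darts ds \<Longrightarrow> closed_darts (rotate i ds)"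
  by (induction i) (auto simp: closed_darts_rotate1)

lemma closed_darts_drop_spur:
  assumes "closed_darts (d # prod.swap d # ys)"
  shows "closed_darts ys"
  unfolding closed_darts_def
proof (intro allI impI)
  fix i assume i: "i < length ys"
  let ?ds = "d # prod.swap d # ys"
  have *: "fst (?ds ! (Suc j mod length ?ds)) = snd (?ds ! j)" if "j < length ?ds" for j
    using assms that unfolding closed_darts_def by blast
  show "fst (ys ! (Suc i mod length ys)) = snd (ys ! i)"
  proof (cases "Suc i = length ys")
    case True
    then show ?thesis using *[of "Suc (Suc i)"] *[of 1] i by (cases "length ys") auto
  next
    case False
    then show ?thesis using *[of "Suc (Suc i)"] i by auto
  qed
qed

lemma count_list_rotate: "count_list (rotate i ds) d = count_list ds d"
proof (induction i)
  case (Suc i)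
  then show ?case by (cases "rotate i ds") auto
qed simp

text \<open>
  Here \<open>\<phi>\<close> assigns to each dart the word it reads: the empty word or a single letter, and reversing
  the dart inverts it. The proof rotates a spur to the front and removes it.
\<close>

lemma short_balanced_closed_word_trivial:
  assumes graph: "bipartite_K23_free p E"
    and \<phi>: "\<And>u v. \<phi> (u, v) = [] \<and> \<phi> (v, u) = [] \<or> (\<exists>a. \<phi> (u, v) = [a] \<and> \<phi> (v, u) = [inv_letter a])"
    and "set ds \<subseteq> E" "closed_darts ds" "balanced ds" "length ds < 14"
  shows "free_reduction (concat (map \<phi> ds)) = []"
  using assms(3-6)
proof (induction ds rule: length_induct)
  case (1 ds)
  note IH = 1(1) and prems = 1(2-5)
  show ?case
  proof (cases "ds = []")
    case False
    have graph': "bipartite_K23_free p (set ds)"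
      by (rule bipartite_K23_free_mono[OF graph prems(1)])
    obtain i where i: "i < length ds" "ds ! (Suc i mod length ds) = prod.swap (ds ! i)"
      using closed_balanced_darts_have_spur[OF prems(2,3) graph' False prems(4)] by blast
    obtain u v where uv: "ds ! i = (u, v)" by fastforce
    have "(u, v) \<in> set ds" using i(1) uv by (metis nth_mem)
    then have "p u \<noteq> p v" using graph' by (auto simp: bipartite_K23_free_def)
    define es where "es = rotate i ds"
    have len: "length es = length ds" by (simp add: es_def)
    have "length ds \<noteq> 1"
    proof
      assume "length ds = 1"
      then have "ds ! i = (v, u)" using i(1) i(2)[unfolded uv] by simp
      then have "u = v" using uv by (metis prod.inject)
      then show False using \<open>p u \<noteq> p v\<close> by simp
    qed
    then have "2 \<le> length es" using i len by linarith
    then obtain d d' ys where dd': "es = d # d' # ys"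
      by (auto simp: numeral_2_eq_2 Suc_le_length_iff)
    have "es ! 0 = (u, v)"
      unfolding es_def using i uv by (subst nth_rotate) auto
    moreover have "es ! 1 = (v, u)"
      unfolding es_def using i uv \<open>2 \<le> length es\<close> len by (subst nth_rotate) simp_all
    ultimately have es: "es = (u, v) # (v, u) # ys" by (simp add: dd')
    have "closed_darts es"
      unfolding es_def by (rule closed_darts_rotate[OF prems(2)])
    then have "closed_darts ys"
      using closed_darts_drop_spur[of "(u, v)" ys] by (simp add: es)
    moreover have "balanced ys"
      unfolding balanced_def
    proof
      fix d
      have "count_list es (prod.swap d) = count_list es d"
        using prems(3) unfolding balanced_def es_def count_list_rotate by blast
      moreover have "count_list es d' = of_bool (d' = (u, v)) + of_bool (d' = (v, u)) + count_list ys d'"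
        for d' by (auto simp: es)
      moreover have "prod.swap d = (a, b) \<longleftrightarrow> d = (b, a)" for a b by (cases d) auto
      ultimately show "count_list ys (prod.swap d) = count_list ys d" by simp
    qed
    moreover have "set ys \<subseteq> E" 
    proof -
      have "set es \<subseteq> E" using prems(1) by (simp add: es_def)
      then show ?thesis by (simp add: es)
    qed
    moreover have "length ys < length ds" using es len by simp
    ultimately have "free_reduction (concat (map \<phi> ys)) = []"
      using IH prems(4) by (meson less_trans)
    moreover have "free_reduction (concat (map \<phi> es)) = free_reduction (concat (map \<phi> ys))"
      using \<phi>[of u v] by (auto simp: es free_reduction_cancel)
    ultimately have "free_reduction (concat (map \<phi> es)) = []" by simp
    then show ?thesis
      using free_reduction_append_commute_Nil[of "concat (map \<phi> (drop j ds))" "concat (map \<phi> (take j ds))" for j]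
      by (simp add: es_def rotate_drop_take flip: concat_append map_append)
  qed (simp add: free_reduction_def)
qed

section \<open>Net flow along tree edges\<close>

lemma path_edges_subset_iff:
  "path_edges p \<subseteq> T \<longleftrightarrow> successively (\<lambda>u v. {u, v} \<in> T) p"
proof (induction p rule: induct_list012)
  case (3 x y p)
  have "path_edges (x # y # p) = insert {x, y} (path_edges (y # p))"
    by (auto simp: path_edges_def)
  then show ?case using 3 by simp
qed (simp_all add: path_edges_def)

lemma rtrancl_simple_path:
  assumes "(a, b) \<in> {(x, y). {x, y} \<in> T}\<^sup>*"
  shows "\<exists>p. p \<noteq> [] \<and> hd p = a \<and> last p = b \<and> distinct p \<and> path_edges p \<subseteq> T"
  using assms
proof (induction rule: rtrancl_induct)
  case base
  show ?case by (rule exI[of _ "[a]"]) (simp add: path_edges_def)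
next
  case (step y z)
  then obtain p where p: "p \<noteq> []" "hd p = a" "last p = y" "distinct p"
      "successively (\<lambda>u v. {u, v} \<in> T) p"
    unfolding path_edges_subset_iff by blast
  show ?case
  proof (cases "z \<in> set p")
    case True
    then obtain xs ys where xs: "p = xs @ z # ys" by (meson split_list)
    have "hd (xs @ [z]) = a" using p(2) unfolding xs by (cases xs) simp_all
    moreover have "distinct (xs @ [z])" using p(4) unfolding xs by simp
    moreover have "successively (\<lambda>u v. {u, v} \<in> T) (xs @ [z])"
      using p(5) unfolding xs by (simp add: successively_append_iff)
    ultimately show ?thesis
      unfolding path_edges_subset_iff by (intro exI[of _ "xs @ [z]"]) simp
  next
    case False
    with p step.hyps(2) show ?thesis
      unfolding path_edges_subset_iff
      by (intro exI[of _ "p @ [z]"]) (simp add: successively_append_iff)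
  qed
qed

lemma sum_list_eq_sum_count:
  fixes g :: "'a \<Rightarrow> int"
  assumes "finite S" "set ds \<subseteq> S"
  shows "(\<Sum>d\<leftarrow>ds. g d) = (\<Sum>d\<in>S. int (count_list ds d) * g d)"
  using assms(2)
proof (induction ds)
  case (Cons e ds)
  have "(\<Sum>d\<in>S. int (count_list (e # ds) d) * g d)
      = (\<Sum>d\<in>S. (if d = e then g d else 0) + int (count_list ds d) * g d)"
    by (intro sum.cong) (auto simp: algebra_simps)
  also have "\<dots> = g e + (\<Sum>d\<in>S. int (count_list ds d) * g d)"
    using Cons.prems \<open>finite S\<close> by (simp add: sum.distrib)
  finally show ?case using Cons by simp
qed simp

lemma closed_darts_potential_sum:
  fixes \<chi> :: "'v \<Rightarrow> int"
  assumes "closed_darts ds"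
  shows "(\<Sum>d\<leftarrow>ds. \<chi> (snd d) - \<chi> (fst d)) = 0"
proof -
  have "map snd ds = map fst (rotate1 ds)"
    using assms by (intro nth_equalityI) (auto simp: closed_darts_def nth_rotate1)
  then have "(\<Sum>d\<leftarrow>ds. \<chi> (snd d)) = (\<Sum>d\<leftarrow>rotate1 ds. \<chi> (fst d))"
    by (metis (no_types, lifting) map_map comp_def map_eq_conv)
  also have "\<dots> = (\<Sum>d\<leftarrow>ds. \<chi> (fst d))" by (cases ds) simp_all
  finally show ?thesis by (simp add: sum_list_subtractf)
qed

text \<open>
  For a tree edge joining \<open>a\<close> to \<open>b\<close> let \<open>\<chi>\<close> be the indicator of the vertices joined to \<open>a\<close> by the other
  edges of \<open>T\<close>. The increments of \<open>\<chi>\<close> along a closed walk add up to \<open>0\<close>. Only cotree edges and the edge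
  from \<open>a\<close> to \<open>b\<close> contribute, and the former cancel.
\<close>

lemma balanced_if_cotree_balanced:
  assumes closed: "closed_darts ds" and acyclic: "\<nexists>p. graph_cycle T p"
    and cotree: "\<And>u v. {u, v} \<notin> T \<Longrightarrow> count_list ds (v, u) = count_list ds (u, v)"
  shows "balanced ds"
  unfolding balanced_def
proof
  fix e :: "'a \<times> 'a"
  obtain a b where e: "e = (a, b)" by fastforce
  show "count_list ds (prod.swap e) = count_list ds e"
  proof (cases "a = b \<or> {a, b} \<notin> T")
    case True
    then show ?thesis
    proof
      assume "{a, b} \<notin> T"
      then show ?thesis using cotree[of a b] by (simp add: e)
    qed (simp add: e)
  next
    case False
    then have ab: "a \<noteq> b" "{a, b} \<in> T" by auto
    define R where "R = {(x, y). {x, y} \<in> T - {{a, b}}}"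
    define \<chi> :: "'a \<Rightarrow> int" where "\<chi> x = of_bool ((a, x) \<in> R\<^sup>*)" for x
    have "(a, b) \<notin> R\<^sup>*"
    proof
      assume "(a, b) \<in> R\<^sup>*"
      then obtain p where p: "p \<noteq> []" "hd p = a" "last p = b" "distinct p"
          "path_edges p \<subseteq> T - {{a, b}}"
        unfolding R_def by (elim rtrancl_simple_path[elim_format] exE conjE) rule
      have "\<not> length p \<le> 2"
      proof
        assume "length p \<le> 2"
        then consider x where "p = [x]" | x y where "p = [x, y]"
          using p(1) by (cases p rule: remdups_adj.cases) auto
        then show False
        proof cases
          case 1
          then show False using p(2,3) ab(1) by simp
        next
          case 2
          then have "p = [a, b]" using p(2,3) by simp
          then show False using p(5) by (simp add: path_edges_def)
        qed
      qed
      then have "graph_cycle T p"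
        using p(2-5) ab(2) unfolding graph_cycle_def by (auto simp: insert_commute)
      then show False using acyclic by blast
    qed
    then have \<chi>: "\<chi> a = 1" "\<chi> b = 0" by (simp_all add: \<chi>_def)
    have \<chi>_tree: "\<chi> x = \<chi> y" if "{x, y} \<in> T" "{x, y} \<noteq> {a, b}" for x y
    proof -
      have "(x, y) \<in> R" "(y, x) \<in> R" using that by (auto simp: R_def insert_commute)
      then have "(a, x) \<in> R\<^sup>* \<longleftrightarrow> (a, y) \<in> R\<^sup>*" by (meson rtrancl_into_rtrancl)
      then show ?thesis by (simp add: \<chi>_def)
    qed
    define S where "S = set ds \<union> prod.swap ` set ds \<union> {(a, b), (b, a)}"
    define k where "k d = int (count_list ds d)" for d
    define g where "g d = \<chi> (snd d) - \<chi> (fst d)" for d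
    have S: "finite S" "set ds \<subseteq> S" "{(a, b), (b, a)} \<subseteq> S" by (auto simp: S_def)
    have swap_S: "prod.swap ` S = S" by (auto simp: S_def image_Un image_image)
    have g_swap: "g (prod.swap d) = - g d" for d by (simp add: g_def)
    have zero: "(\<Sum>d\<in>S. k d * g d) = 0"
      using sum_list_eq_sum_count[OF S(1,2), of g] closed_darts_potential_sum[OF closed, of \<chi>]
      unfolding k_def g_def by simp
    have "(\<Sum>d\<in>S. k (prod.swap d) * g (prod.swap d)) = (\<Sum>d\<in>S. k d * g d)"
      using sum.reindex[OF inj_on_subset[OF inj_swap subset_UNIV], of "\<lambda>d. k d * g d" S]
      unfolding swap_S comp_def by (rule sym)
    \<comment> \<open>Adding the same sum over the reversed darts makes the balanced edges drop out.\<close>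
    then have "0 = (\<Sum>d\<in>S. (k d - k (prod.swap d)) * g d)"
      using zero by (simp add: g_swap left_diff_distrib sum_subtractf sum_negf)
    also have "\<dots> = (\<Sum>d\<in>{(a, b), (b, a)}. (k d - k (prod.swap d)) * g d)"
    proof (rule sum.mono_neutral_right[OF S(1,3)], rule ballI)
      fix d assume d: "d \<in> S - {(a, b), (b, a)}"
      obtain x y where xy: "d = (x, y)" by fastforce
      show "(k d - k (prod.swap d)) * g d = 0"
      proof (cases "{x, y} \<in> T")
        case True
        moreover have "{x, y} \<noteq> {a, b}" using d xy by (auto simp: doubleton_eq_iff)
        ultimately show ?thesis using \<chi>_tree by (simp add: g_def xy)
      next
        case False
        then show ?thesis using cotree[OF False] by (simp add: k_def xy)
      qed
    qed
    also have "\<dots> = 2 * (k (b, a) - k (a, b))" using ab(1) \<chi> by (simp add: g_def)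
    finally have "k (a, b) = k (b, a)" by simp
    then show ?thesis by (simp add: k_def e)
  qed
qed

section \<open>Words read along walks\<close>

lemma exponent_sum_walk:
  assumes "inj_on \<beta> D" and asym: "\<And>a b. (a, b) \<in> D \<Longrightarrow> (b, a) \<notin> D" and uv: "(u, v) \<in> D"
  shows "exponent_sum (\<beta> (u, v)) (concat (map (step_word D \<beta>) ds))
      = int (count_list ds (u, v)) - int (count_list ds (v, u))"
proof (induction ds)
  case (Cons d ds)
  obtain s t where d: "d = (s, t)" by fastforce
  have eq_iff: "\<beta> d' = \<beta> (u, v) \<longleftrightarrow> d' = (u, v)" if "d' \<in> D" for d'
    by (rule inj_on_eq_iff[OF assms(1) that uv])
  have "exponent_sum (\<beta> (u, v)) (step_word D \<beta> d) = of_bool (d = (u, v)) - of_bool (d = (v, u))"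
  proof -
    consider "(s, t) \<in> D" | "(s, t) \<notin> D" "(t, s) \<in> D" | "(s, t) \<notin> D" "(t, s) \<notin> D" by blast
    then show ?thesis
    proof cases
      case 1
      then have "(s, t) \<noteq> (v, u)" using asym[OF uv] by metis
      then show ?thesis by (simp add: 1 d step_word_def exponent_sum_def eq_iff[OF 1] del: prod.inject)
    next
      case 2
      then have "(s, t) \<noteq> (u, v)" using uv by metis
      moreover have "(t, s) = (u, v) \<longleftrightarrow> (s, t) = (v, u)" by auto
      ultimately show ?thesis by (simp add: 2 d step_word_def exponent_sum_def eq_iff[OF 2(2)] del: prod.inject)
    next
      case 3
      then have "(s, t) \<noteq> (u, v)" "(s, t) \<noteq> (v, u)" using uv by blast+
      then show ?thesis by (simp add: 3 d step_word_def exponent_sum_def del: prod.inject)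
    qed
  qed
  then have "exponent_sum (\<beta> (u, v)) (concat (map (step_word D \<beta>) (d # ds)))
      = of_bool (d = (u, v)) - of_bool (d = (v, u))
        + (int (count_list ds (u, v)) - int (count_list ds (v, u)))"
    using Cons.IH by (simp add: exponent_sum_def)
  moreover have "int (count_list (d # ds) e) = of_bool (d = e) + int (count_list ds e)" for e
    by simp
  ultimately show ?case by (simp only:)
qed (simp add: exponent_sum_def)

lemma step_word_reverse:
  assumes "\<And>a b. (a, b) \<in> D \<Longrightarrow> (b, a) \<notin> D"
  shows "step_word D \<beta> (u, v) = [] \<and> step_word D \<beta> (v, u) = [] \<or>
    (\<exists>a. step_word D \<beta> (u, v) = [a] \<and> step_word D \<beta> (v, u) = [inv_letter a])"
proof -
  have "\<not> ((u, v) \<in> D \<and> (v, u) \<in> D)" using assms by blast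
  then show ?thesis by (auto simp: step_word_def inv_letter_def)
qed

section \<open>The cube\<close>

lemma cube_adj_iff_flip:
  "cube_adj n u v \<longleftrightarrow> u \<in> cube_verts n \<and> (\<exists>i<n. v = flip i u)"
proof
  assume adj: "cube_adj n u v"
  then obtain i where i: "i < n" "u ! i \<noteq> v ! i" "\<And>j. j < n \<Longrightarrow> u ! j \<noteq> v ! j \<Longrightarrow> j = i"
    unfolding cube_adj_def by blast
  have len: "length u = n" "length v = n" using adj by (auto simp: cube_adj_def cube_verts_def)
  have "v = flip i u"
  proof (rule nth_equalityI)
    fix j assume "j < length v"
    then show "v ! j = flip i u ! j"
    proof (cases "j = i")
      case True
      have "v ! i = (\<not> u ! i)" using i(2) by blast
      then show ?thesis using i(1) len by (simp add: True flip_def)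
    next
      case False
      then have "v ! j = u ! j" using i(3)[of j] \<open>j < length v\<close> len by metis
      then show ?thesis using False by (simp add: flip_def)
    qed
  qed (simp add: flip_def len)
  then show "u \<in> cube_verts n \<and> (\<exists>i<n. v = flip i u)"
    using adj i(1) by (auto simp: cube_adj_def)
next
  assume "u \<in> cube_verts n \<and> (\<exists>i<n. v = flip i u)"
  then show "cube_adj n u v"
    by (auto simp: cube_adj_def cube_verts_def flip_def nth_list_update split: if_splits)
qed

lemma cube_adj_sym: "cube_adj n u v \<Longrightarrow> cube_adj n v u"
  unfolding cube_adj_def by metis

lemma cube_adj_irrefl: "\<not> cube_adj n u u"
  by (auto simp: cube_adj_def)

lemma in_cube_edges_iff: "{u, v} \<in> cube_edges n \<longleftrightarrow> cube_adj n u v"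
  unfolding cube_edges_def by (auto simp: doubleton_eq_iff cube_adj_sym)

text \<open>The two-colouring of the cube: whether the number of coordinates equal to \<open>1\<close> is even.\<close>

definition vertex_parity :: "vertex \<Rightarrow> bool" where
  "vertex_parity v = even (length (filter id v))"

lemma vertex_parity_flip: "i < length v \<Longrightarrow> vertex_parity (flip i v) \<noteq> vertex_parity v"
proof (induction v arbitrary: i)
  case (Cons b v)
  then show ?case by (cases i) (auto simp: vertex_parity_def flip_def)
qed simp

text \<open>
  A common neighbour of \<open>u\<close> and \<open>v\<close> arises from \<open>u\<close> by flipping one of the coordinates in which \<open>u\<close> and
  \<open>v\<close> differ. For \<open>u \<noteq> v\<close> with a common neighbour there are just two such coordinates.
\<close>

lemma cube_two_common_neighbours:
  assumes "distinct [x, y, z]"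
    and u: "cube_adj n u x" "cube_adj n u y" "cube_adj n u z"
    and v: "cube_adj n v x" "cube_adj n v y" "cube_adj n v z"
  shows "u = v"
proof (rule ccontr)
  assume "u \<noteq> v"
  define diff where "diff = {i. i < n \<and> u ! i \<noteq> v ! i}"
  have diff: "\<exists>i j. w = flip i u \<and> i \<in> diff \<and> diff = {i, j}"
    if uw: "cube_adj n u w" and vw: "cube_adj n v w" for w
  proof -
    obtain i j where i: "i < n" "w = flip i u" and j: "j < n" "v = flip j w"
      and len: "length u = n"
      using uw cube_adj_sym[OF vw] by (auto simp: cube_adj_iff_flip cube_verts_def)
    have "i \<noteq> j"
    proof
      assume "i = j"
      then have "v = u" using i j len by (simp add: flip_def)
      then show False using \<open>u \<noteq> v\<close> by simp
    qed
    then have "diff = {i, j}"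
      using i j len by (auto simp: diff_def flip_def nth_list_update split: if_splits)
    then show ?thesis using i by auto
  qed
  obtain i j where i: "x = flip i u" "i \<in> diff" "diff = {i, j}" using diff u(1) v(1) by blast
  moreover obtain k where "y = flip k u" "k \<in> diff" using diff u(2) v(2) by blast
  moreover obtain l where "z = flip l u" "l \<in> diff" using diff u(3) v(3) by blast
  ultimately show False using \<open>distinct [x, y, z]\<close> by auto
qed

lemma bipartite_K23_free_cube: "bipartite_K23_free vertex_parity {(u, v). cube_adj n u v}"
proof -
  have "vertex_parity u \<noteq> vertex_parity v" if adj: "cube_adj n u v" for u v
  proof -
    obtain i where "i < length u" "v = flip i u"
      using adj by (auto simp: cube_adj_iff_flip cube_verts_def)
    then show ?thesis using vertex_parity_flip[of i u] by blast
  qed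
  then have "\<forall>(u, v) \<in> {(u, v). cube_adj n u v}. vertex_parity u \<noteq> vertex_parity v"
    by blast
  moreover have "u = v"
    if "distinct [x, y, z]"
      and "{(u, x), (u, y), (u, z), (v, x), (v, y), (v, z)} \<subseteq> {(u, v). cube_adj n u v}"
    for u v x y z
  proof -
    have adj: "cube_adj n u x" "cube_adj n u y" "cube_adj n u z"
        "cube_adj n v x" "cube_adj n v y" "cube_adj n v z"
      using that(2) by simp_all
    show ?thesis by (rule cube_two_common_neighbours[OF that(1) adj])
  qed
  then have "\<forall>u v x y z. distinct [x, y, z] \<longrightarrow>
      {(u, x), (u, y), (u, z), (v, x), (v, y), (v, z)} \<subseteq> {(u, v). cube_adj n u v} \<longrightarrow> u = v"
    by (intro allI impI) assumption+
  ultimately show ?thesis unfolding bipartite_K23_free_def by (rule conjI)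
qed

lemma closed_walk_darts:
  assumes "closed_walk n v w"
  shows "set (zip w (tl w)) \<subseteq> {(u, v). cube_adj n u v}" "closed_darts (zip w (tl w))"
proof -
  have w: "w \<noteq> []" "successively (cube_adj n) w" "hd w = last w"
    using assms by (auto simp: closed_walk_def)
  have "set (zip w (tl w)) \<subseteq> {(u, v). R u v}" if "successively R w" for R
    using that by (induction w rule: induct_list012) auto
  then show "set (zip w (tl w)) \<subseteq> {(u, v). cube_adj n u v}" using w(2) .
  show "closed_darts (zip w (tl w))"
    unfolding closed_darts_def
  proof (intro allI impI)
    fix i assume i: "i < length (zip w (tl w))"
    let ?m = "length (zip w (tl w))"
    have m: "?m = length w - 1" by simp
    show "fst (zip w (tl w) ! (Suc i mod ?m)) = snd (zip w (tl w) ! i)"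
    proof (cases "Suc i = ?m")
      case True
      then have "snd (zip w (tl w) ! i) = last w"
        using i w(1) by (simp add: nth_tl last_conv_nth)
      moreover have "fst (zip w (tl w) ! (Suc i mod ?m)) = hd w"
        using True i w(1) by (simp add: hd_conv_nth)
      ultimately show ?thesis using w(3) by simp
    next
      case False
      then have "Suc i < ?m" using i by simp
      then show ?thesis by (simp add: nth_tl)
    qed
  qed
qed

lemma flip_walk_in_cube:
  assumes "v \<in> cube_verts n" "set is \<subseteq> {..<n}"
  shows "hd (flip_walk v is) = v" "set (flip_walk v is) \<subseteq> cube_verts n"
    "successively (cube_adj n) (flip_walk v is)"
  using assms
proof (induction "is" arbitrary: v)
  case (Cons i "is")
  {
    case 1
    show ?case by simp
  next
    case 2
    then have "flip i v \<in> cube_verts n" by (simp add: cube_verts_def flip_def)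
    then show ?case using 2 Cons.IH(2) by simp
  next
    case 3
    then have "flip i v \<in> cube_verts n" "cube_adj n v (flip i v)"
      by (auto simp: cube_verts_def flip_def cube_adj_iff_flip)
    then show ?case using 3 Cons.IH(1,3)[of "flip i v"] by (auto simp: successively_Cons)
  }
qed simp_all

lemma distinct_coordinates:
  fixes c :: "nat \<Rightarrow> nat"
  assumes "inj_on c {0, 1, 2}" "c ` {0, 1, 2} \<subseteq> {..<m}"
  shows "c 0 \<noteq> c 1" "c 0 \<noteq> c 2" "c 1 \<noteq> c 2" "c 0 < m" "c 1 < m" "c 2 < m"
  using assms by (simp_all add: inj_on_def)

lemma flip_copy_vertex:
  assumes "inj_on c {0, 1, 2}" "c ` {0, 1, 2} \<subseteq> {..<length h}" "q \<in> {0, 1, 2}"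
  shows "flip (c q) (copy_vertex h c m) = copy_vertex h c (flip_bit q m)"
proof -
  note c = distinct_coordinates[OF assms(1,2)]
  define B where "B = copy_vertex h c m"
  have B: "length B = length h" "B ! c 0 = bit m 0" "B ! c 1 = bit m 1" "B ! c 2 = bit m 2"
    using c by (simp_all add: B_def copy_vertex_def)
  have "B[c q := \<not> bit m q] = copy_vertex h c (flip_bit q m)"
    using assms(3) c
    by (elim insertE emptyE)
      (simp_all add: B_def copy_vertex_def bit_flip_bit_iff list_update_swap)
  moreover have "B ! c q = bit m q" using assms(3) B by auto
  ultimately show ?thesis by (simp add: flip_def B_def)
qed

lemma bit_eq_if_copy_vertex_eq:
  assumes "inj_on c {0, 1, 2}" "c ` {0, 1, 2} \<subseteq> {..<length h}"
    and eq: "copy_vertex h c a = copy_vertex h c b" and "q \<in> {0, 1, 2}"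
  shows "bit a q = bit b q"
proof -
  note c = distinct_coordinates[OF assms(1,2)]
  show ?thesis
    using arg_cong[OF eq, of "\<lambda>v. v ! c q"] c assms(4)
    by (auto simp: copy_vertex_def nth_list_update)
qed

section \<open>The minimum\<close>

lemma orientation_asym:
  assumes D: "orientation (cube_edges n - T) D" and ab: "(a, b) \<in> D"
  shows "(b, a) \<notin> D"
proof
  assume "(b, a) \<in> D"
  have "inj_on (\<lambda>(u, v). {u, v}) D" using D by (simp add: orientation_def bij_betw_def)
  then have "(a, b) = (b, a)"
    by (rule inj_onD) (use ab \<open>(b, a) \<in> D\<close> in \<open>simp_all add: insert_commute\<close>)
  then have "a = b" by (rule Pair_inject)
  moreover have "{a, b} \<in> cube_edges n"
    using ab D by (force simp: orientation_def bij_betw_def)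
  ultimately show False using cube_adj_irrefl in_cube_edges_iff by metis
qed

lemma short_walk_word_trivial:
  assumes w: "closed_walk n v w" "walk_length w < 14"
    and acyclic: "\<nexists>p. graph_cycle T p"
    and D: "orientation (cube_edges n - T) D" and \<beta>: "inj_on \<beta> D"
    and word: "walk_word D \<beta> w \<in> lower_central (free_group X) 2"
  shows "walk_word D \<beta> w = []"
proof -
  let ?ds = "zip w (tl w)"
  have D_img: "(\<lambda>(u, v). {u, v}) ` D = cube_edges n - T"
    using D by (simp add: orientation_def bij_betw_def)
  note asym = orientation_asym[OF D]
  note ds = closed_walk_darts[OF w(1)]
  have dart: "count_list ?ds (v, u) = count_list ?ds (u, v)" if "(u, v) \<in> D" for u v
    using exponent_sum_walk[OF \<beta> asym that, of ?ds]
      exponent_sum_lower_central_2[OF word[unfolded walk_word_def], of "\<beta> (u, v)"] by simp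
  have "count_list ?ds (v, u) = count_list ?ds (u, v)" if "{u, v} \<notin> T" for u v
  proof (cases "cube_adj n u v")
    case True
    then have "{u, v} \<in> (\<lambda>(u, v). {u, v}) ` D" using that D_img by (simp add: in_cube_edges_iff)
    then have "(u, v) \<in> D \<or> (v, u) \<in> D" by (auto simp: doubleton_eq_iff)
    then show ?thesis using dart by metis
  next
    case False
    then have "(u, v) \<notin> set ?ds" "(v, u) \<notin> set ?ds" using ds(1) cube_adj_sym by blast+
    then show ?thesis by simp
  qed
  then have "balanced ?ds" by (rule balanced_if_cotree_balanced[OF ds(2) acyclic])
  then show ?thesis
    unfolding walk_word_def
    using w(2) ds step_word_reverse[of D, OF asym]
    by (intro short_balanced_closed_word_trivial[OF bipartite_K23_free_cube]) (auto simp: walk_length_def)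
qed

text \<open>The word \<open>w\<close> is the commutator of \<open>a\<^sup>-\<^sup>1\<close> and \<open>b c\<^sup>-\<^sup>1\<close>.\<close>

lemma commutator_word_in_lower_central_2:
  assumes "a \<in> X" "b \<in> X" "c \<in> X" "distinct [a, b, c]"
  defines "w \<equiv> [(a, False), (b, True), (c, False), (a, True), (c, True), (b, False)]"
  shows "w \<in> lower_central (free_group X) 2" "w \<notin> lower_central (free_group X) 3"
    "free_reduction w = w"
proof -
  let ?F = "free_group X"
  interpret group ?F by (rule group_free_group)
  let ?h = "[(a, False)]" and ?k = "[(b, True), (c, False)]"
  have inv_h: "inv\<^bsub>?F\<^esub> ?h = [(a, True)]"
    by (rule inv_equality)
      (use assms in \<open>auto simp: free_group_def free_reduction_def inv_letter_def reduced_word_def\<close>)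
  have inv_k: "inv\<^bsub>?F\<^esub> ?k = [(c, True), (b, False)]"
    by (rule inv_equality)
      (use assms in \<open>auto simp: free_group_def free_reduction_def inv_letter_def reduced_word_def\<close>)
  have "w = ?h \<otimes>\<^bsub>?F\<^esub> ?k \<otimes>\<^bsub>?F\<^esub> inv\<^bsub>?F\<^esub> ?h \<otimes>\<^bsub>?F\<^esub> inv\<^bsub>?F\<^esub> ?k"
    unfolding inv_h inv_k using assms
    by (auto simp: free_group_def free_reduction_def inv_letter_def)
  moreover have "?h \<in> carrier ?F" "?k \<in> carrier ?F"
    using assms by (auto simp: free_group_def inv_letter_def reduced_word_def)
  ultimately show "w \<in> lower_central ?F 2"
    unfolding numeral_2_eq_2 lower_central.simps commutator_subgroup_def
    by (intro generate.incl) blast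
  show "free_reduction w = w"
    using assms by (auto simp: free_reduction_def inv_letter_def)
  show "w \<notin> lower_central ?F 3"
  proof
    assume "w \<in> lower_central ?F 3"
    then have "heisenberg_value a b w \<in> {(0, 0, 0)}"
      by (intro subsetD[OF lower_central_heisenberg_3] heisenberg_value_lower_central)
    moreover have "a \<noteq> b" "b \<noteq> a" "c \<noteq> a" "c \<noteq> b" using assms(4) by auto
    ultimately show False by (simp add: w_def heisenberg_value_def word_value_def)
  qed
qed

theorem theorem9p1:
  fixes n :: nat
    and c :: "nat \<Rightarrow> nat" and h v0 :: vertex
    and T :: "vertex set set" and D :: "(vertex \<times> vertex) set"
    and \<beta> :: "vertex \<times> vertex \<Rightarrow> nat"
    and W :: "vertex list"
  defines "v0 \<equiv> copy_vertex h c 0"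
    and "W \<equiv> flip_walk v0 (map c W_steps)"
  assumes "n \<ge> 3"
    and "inj_on c {0, 1, 2}" and "c ` {0, 1, 2} \<subseteq> {..<n}" and "h \<in> cube_verts n"
    and "spanning_tree (cube_verts n) (cube_edges n) T"
    and "path_edges (map (copy_vertex h c) gray_path) \<subseteq> T"
    and "orientation (cube_edges n - T) D"
    and "\<And>a b. (a, b) \<in> gray_cotree \<Longrightarrow> (copy_vertex h c a, copy_vertex h c b) \<in> D"
    and "bij_betw \<beta> D {..<cycle_rank n}"
  shows "(let F = free_group {..<cycle_rank n};
              A = {w. closed_walk n v0 w \<and>
                      walk_word D \<beta> w \<in> lower_central F 2 - lower_central F 3}
          in A \<noteq> {} \<and> (LEAST m. \<exists>w\<in>A. walk_length w = m) = 14 \<and>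
             W \<in> A \<and> walk_length W = 14)"
proof -
  let ?F = "free_group {..<cycle_rank n}" and ?V = "copy_vertex h c"
  define A where "A = {w. closed_walk n v0 w \<and>
    walk_word D \<beta> w \<in> lower_central ?F 2 - lower_central ?F 3}"
  note c_inj = assms(4) and h = assms(6) and T = assms(7)
    and gray = assms(8) and D = assms(9) and D_gray = assms(10) and \<beta> = assms(11)
  have c: "c ` {0, 1, 2} \<subseteq> {..<length h}" and len_h: "length h = n"
    using assms(5) h by (auto simp: cube_verts_def)
  have acyclic: "\<nexists>p. graph_cycle T p" using T by (simp add: spanning_tree_def)
  have \<beta>_inj: "inj_on \<beta> D" using \<beta> by (simp add: bij_betw_def)

  have lower: "14 \<le> walk_length w" if "w \<in> A" for w
  proof (rule ccontr)
    assume "\<not> 14 \<le> walk_length w"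
    then have "walk_word D \<beta> w = []"
      using that short_walk_word_trivial[OF _ _ acyclic D \<beta>_inj] by (auto simp: A_def)
    moreover have "[] \<in> lower_central ?F 3"
      using generate.one[of ?F] by (simp add: numeral_3_eq_3 commutator_subgroup_def free_group_def)
    ultimately show False using that by (simp add: A_def)
  qed

  have W: "W = map ?V [0, 1, 3, 2, 0, 4, 5, 1, 0, 2, 3, 1, 5, 4, 0]"
    by (simp add: W_def v0_def W_steps_def flip_copy_vertex[OF c_inj c] flip_bit_eq_xor push_bit_eq_mult)
  have v0: "v0 \<in> cube_verts n" using len_h by (simp add: v0_def copy_vertex_def cube_verts_def)
  have W_closed: "closed_walk n v0 W"
    using flip_walk_in_cube[OF v0, of "map c W_steps"] assms(5)
    unfolding closed_walk_def W_def[symmetric]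
    by (auto simp: W_steps_def W v0_def)
  have tree: "{?V a, ?V b} \<in> T" if "(a, b) \<in> {(0, 1), (1, 3), (3, 2), (2, 6), (6, 7), (7, 5), (5, 4)}" for a b
    using that gray by (auto simp: path_edges_subset_iff gray_path_def)
  have D_tree: "{u, v} \<notin> T" if "(u, v) \<in> D" for u v
    using that D by (force simp: orientation_def bij_betw_def)
  have step_tree: "step_word D \<beta> (?V a, ?V b) = []" "step_word D \<beta> (?V b, ?V a) = []"
    if "(a, b) \<in> {(0, 1), (1, 3), (3, 2), (2, 6), (6, 7), (7, 5), (5, 4)}" for a b
    using tree[OF that] D_tree[of "?V a" "?V b"] D_tree[of "?V b" "?V a"]
    by (auto simp: step_word_def insert_commute)
  have step_cotree: "step_word D \<beta> (?V a, ?V b) = [(\<beta> (?V a, ?V b), True)]"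
      "step_word D \<beta> (?V b, ?V a) = [(\<beta> (?V a, ?V b), False)]"
    if "(a, b) \<in> gray_cotree" for a b
    using D_gray[OF that] orientation_asym[OF D D_gray[OF that]] by (simp_all add: step_word_def)
  let ?a = "\<beta> (?V 0, ?V 2)" and ?b = "\<beta> (?V 0, ?V 4)" and ?c = "\<beta> (?V 1, ?V 5)"
  let ?word = "[(?a, False), (?b, True), (?c, False), (?a, True), (?c, True), (?b, False)]"
  have "concat (map (step_word D \<beta>) (zip W (tl W))) = ?word"
    by (simp add: W step_tree step_cotree gray_cotree_def)
  moreover have abc: "(?V 0, ?V 2) \<in> D" "(?V 0, ?V 4) \<in> D" "(?V 1, ?V 5) \<in> D"
    using D_gray by (simp_all add: gray_cotree_def)
  then have "?a \<in> {..<cycle_rank n}" "?b \<in> {..<cycle_rank n}" "?c \<in> {..<cycle_rank n}"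
    using \<beta> unfolding bij_betw_def by blast+
  moreover have "distinct [?a, ?b, ?c]"
  proof -
    have "?V 2 \<noteq> ?V 4" "?V 0 \<noteq> ?V 1"
      using bit_eq_if_copy_vertex_eq[OF c_inj c, of 2 4 1] bit_eq_if_copy_vertex_eq[OF c_inj c, of 0 1 0]
      by (auto simp: bit_Suc_0_iff)
    then show ?thesis using inj_on_eq_iff[OF \<beta>_inj] abc by auto
  qed
  ultimately have "W \<in> A"
    using W_closed commutator_word_in_lower_central_2[of ?a "{..<cycle_rank n}" ?b ?c]
    unfolding A_def walk_word_def by simp
  moreover have "walk_length W = 14" by (simp add: W walk_length_def)
  moreover have "(LEAST m. \<exists>w\<in>A. walk_length w = m) = 14"
    using \<open>W \<in> A\<close> \<open>walk_length W = 14\<close> lower by (intro Least_equality) auto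
  ultimately show ?thesis
    unfolding Let_def A_def[symmetric] by blast
qed

end
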